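(* Let $f: \mathbb{R}^n \to \mathbb{R}$ be a non-negative Morse--Bott function. Suppose that $N := f^{-1}(0)$ is a non-empty submanifold of $\mathbb{R}^n$. Then for any $p \in N$, there is a non-constant gradient flow line $\gamma$ of $f$ with $\lim_{t\to\infty} \gamma(t) = p$.
   Context: A gradient flow line (GF) of $f$ is a curve $\gamma:(a,b)\to\mathbb{R}^n$, $-\infty\le a<b\le\infty$, with $\dot\gamma(t) = -\nabla f(\gamma(t))$ (here $b=\infty$). Let $N'\subseteq \mathbb{R}^n$ be a critical submanifold of $f$ (a submanifold consisting of critical points). It is a non-degenerate critical manifold if for every $x\in N'$ the restriction of the Hessian of $f$ at $x$ to the normal space of $N'$ at $x$ is a non-degenerate bilinear form. A smooth function $f$ is Morse--Bott if its set of critical points is a disjoint union of non-degenerate critical manifolds.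
   Formalization: The formal theorem additionally assumes that N is not all of R^n, i.e. f is not identically zero; for f = 0, which is non-negative and Morse–Bott with N = R^n, every gradient flow line is constant and the claim fails. *)

theory Defs
  imports "HOL-Analysis.Analysis"
begin

text \<open>
  \<open>C\<^sup>k\<close> and smooth maps; meant for open \<open>S\<close> only.  Since every partial derivative of order
  less than \<open>k\<close> is required to be (Frechet) differentiable and those of order \<open>k\<close> to be
  continuous, this is the usual notion.
\<close>

primrec Ck_on :: "nat \<Rightarrow> ('a::euclidean_space \<Rightarrow> 'b::real_normed_vector) \<Rightarrow> 'a set \<Rightarrow> bool" where
  "Ck_on 0 f S \<longleftrightarrow> continuous_on S f"
| "Ck_on (Suc k) f S \<longleftrightarrow>
     (\<forall>x\<in>S. f differentiable (at x)) \<and> (\<forall>v. Ck_on k (\<lambda>x. frechet_derivative f (at x) v) S)"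

definition smooth_on :: "('a::euclidean_space \<Rightarrow> 'b::real_normed_vector) \<Rightarrow> 'a set \<Rightarrow> bool" where
  "smooth_on f S \<longleftrightarrow> (\<forall>k. Ck_on k f S)"

definition grad :: "('a::euclidean_space \<Rightarrow> real) \<Rightarrow> 'a \<Rightarrow> 'a" where
  "grad f x = (THE D. GDERIV f x :> D)"

lemma GDERIV_unique:
  fixes f :: "'a::euclidean_space \<Rightarrow> real"
  assumes "GDERIV f x :> D" "GDERIV f x :> E"
  shows "D = E"
proof -
  have "(\<lambda>h. h \<bullet> D) = (\<lambda>h. h \<bullet> E)"
    using assms unfolding gderiv_def by (rule has_derivative_unique)
  then show ?thesis
    unfolding fun_eq_iff by (simp only: vector_eq_ldot)
qed

lemma grad_eqI: "GDERIV f x :> D \<Longrightarrow> grad f x = D"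
  unfolding grad_def by (rule the_equality, assumption, rule GDERIV_unique)

lemma GDERIV_grad:
  fixes f :: "'a::euclidean_space \<Rightarrow> real"
  assumes "f differentiable (at x)"
  shows "GDERIV f x :> grad f x"
proof -
  let ?f' = "frechet_derivative f (at x)"
  have f': "(f has_derivative ?f') (at x)"
    using assms by (simp add: frechet_derivative_works)
  then have lin: "linear ?f'"
    by (rule has_derivative_linear)
  have "?f' = (\<lambda>h. h \<bullet> adjoint ?f' 1)"
    using adjoint_works [OF lin, of _ 1] by (auto simp: fun_eq_iff)
  then have "GDERIV f x :> adjoint ?f' 1"
    using f' unfolding gderiv_def by metis
  then show ?thesis
    by (simp add: grad_eqI)
qed

definition hessian :: "('a::euclidean_space \<Rightarrow> real) \<Rightarrow> 'a \<Rightarrow> 'a \<Rightarrow> 'a \<Rightarrow> real" where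
  "hessian f x u v = frechet_derivative (grad f) (at x) u \<bullet> v"

text \<open>
  Smooth embedded submanifolds of pure dimension \<open>k\<close>, not necessarily connected or closed, via
  slice charts of the ambient space.
\<close>

definition submanifold :: "nat \<Rightarrow> 'a::euclidean_space set \<Rightarrow> bool" where
  "submanifold k M \<longleftrightarrow>
     (\<forall>x\<in>M. \<exists>U V \<phi> \<psi> S.
        open U \<and> x \<in> U \<and> open (V :: 'a set) \<and>
        homeomorphism U V \<phi> \<psi> \<and> smooth_on \<phi> U \<and> smooth_on \<psi> V \<and>
        subspace S \<and> dim S = k \<and> \<phi> ` (M \<inter> U) = S \<inter> V)"

definition tangent_space :: "'a::euclidean_space set \<Rightarrow> 'a \<Rightarrow> 'a set" where
  "tangent_space M x =
     {v. \<exists>c \<epsilon>. \<epsilon> > 0 \<and> smooth_on c {-\<epsilon><..<\<epsilon>} \<and> c ` {-\<epsilon><..<\<epsilon>} \<subseteq> M \<and>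
               c 0 = x \<and> (c has_vector_derivative v) (at (0::real))}"

definition normal_space :: "'a::euclidean_space set \<Rightarrow> 'a \<Rightarrow> 'a set" where
  "normal_space M x = orthogonal_comp (tangent_space M x)"

definition nondegenerate_on :: "'a::real_vector set \<Rightarrow> ('a \<Rightarrow> 'a \<Rightarrow> real) \<Rightarrow> bool" where
  "nondegenerate_on W B \<longleftrightarrow> (\<forall>u\<in>W. (\<forall>v\<in>W. B u v = 0) \<longrightarrow> u = 0)"

definition critical_points :: "('a::euclidean_space \<Rightarrow> real) \<Rightarrow> 'a set" where
  "critical_points f = {x. grad f x = 0}"

definition critical_submanifold :: "('a::euclidean_space \<Rightarrow> real) \<Rightarrow> 'a set \<Rightarrow> bool" where
  "critical_submanifold f M \<longleftrightarrow> (\<exists>k. submanifold k M) \<and> M \<subseteq> critical_points f"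

definition nondegenerate_critical_manifold :: "('a::euclidean_space \<Rightarrow> real) \<Rightarrow> 'a set \<Rightarrow> bool" where
  "nondegenerate_critical_manifold f M \<longleftrightarrow>
     critical_submanifold f M \<and> (\<forall>x\<in>M. nondegenerate_on (normal_space M x) (hessian f x))"

text \<open>
  The critical manifolds may have different dimensions.  Disjointness is only required
  set-theoretically: nondegeneracy forces each of them to be open in the critical set.
  The zero function is Morse--Bott in this sense (with critical manifold \<open>UNIV\<close>) and all its
  gradient flow lines are constant, so results on non-constant flow lines must exclude it.
\<close>

definition morse_bott :: "('a::euclidean_space \<Rightarrow> real) \<Rightarrow> bool" where
  "morse_bott f \<longleftrightarrow>
     smooth_on f UNIV \<and>
     (\<exists>\<C>. disjoint \<C> \<and> (\<forall>M\<in>\<C>. nondegenerate_critical_manifold f M) \<and>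
          critical_points f = \<Union>\<C>)"

text \<open>The values of \<open>\<gamma>\<close> outside the open interval \<open>(a,b)\<close> are irrelevant.\<close>

definition gradient_flow_line ::
    "('a::euclidean_space \<Rightarrow> real) \<Rightarrow> ereal \<Rightarrow> ereal \<Rightarrow> (real \<Rightarrow> 'a) \<Rightarrow> bool" where
  "gradient_flow_line f a b \<gamma> \<longleftrightarrow>
     a < b \<and>
     (\<forall>t. a < ereal t \<and> ereal t < b \<longrightarrow> (\<gamma> has_vector_derivative - grad f (\<gamma> t)) (at t))"

end

theory Submission
  imports Defs
begin

text \<open>
Every point \<open>p\<close> of \<open>N = f -` {0}\<close> is a minimum of \<open>f\<close>, hence a critical point at which the Hessian
\<open>A\<close> is symmetric and positive semidefinite. If \<open>A\<close> has a positive eigenvalue, then \<open>p\<close> has a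
nontrivial strong stable manifold for the flow of \<open>- grad f\<close>, and any trajectory in it other
than \<open>p\<close> itself is a flow line as required. So there are two things to show.

\<^item> \<open>A \<noteq> 0\<close>. This is where the Morse--Bott condition enters: if \<open>A = 0\<close>, the critical manifold
  through \<open>p\<close> has full dimension, so \<open>f\<close> vanishes near \<open>p\<close>; then the submanifold \<open>N\<close> has full
  dimension, is open and closed, and \<open>f\<close> is identically zero (\<open>morse_bott_hessian_nonzero\<close>).

\<^item> A trajectory converging to a critical point \<open>p\<close> with positive semidefinite \<open>A \<noteq> 0\<close>
  (\<open>strong_stable_trajectory\<close>). The Lyapunov--Perron method applies in a simple form when one follows
  the largest eigenvalue \<open>l\<close> of \<open>A\<close>, with eigenvector \<open>e\<close>: prescribe the asymptotics
  \<open>\<gamma> t \<approx> p + \<rho> exp (- l t) e\<close> at \<open>t = \<infinity>\<close> and solve for the correction of size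
  \<open>exp (- 2 l t)\<close> by the Banach fixed point theorem (\<open>semilinear_bounded_solution\<close>). Since the
  correction decays faster than every linear mode of \<open>A\<close>, the equation for the rescaled correction
  is expanding in all directions. Hence it has a bounded solution without any splitting of the
  space into stable and centre parts, and the degenerate directions of \<open>A\<close>, tangent to \<open>N\<close>,
  need no separate treatment.

The remaining lemmas provide the Taylor estimates: the linearization error of \<open>grad f\<close> at \<open>p\<close> is
quadratic, and so \<open>A\<close> is symmetric and positive semidefinite.
\<close>

section \<open>Bounded solutions of expanding equations\<close>

text \<open>
For \<open>c > 0\<close> and bounded \<open>h\<close>, the equation \<open>v' = c v + h\<close> has exactly one solution that stays
bounded as \<open>t \<rightarrow> \<infinity>\<close>; variation of constants started at \<open>t = \<infinity>\<close> gives the formula.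
\<close>

definition bounded_solution :: "real \<Rightarrow> (real \<Rightarrow> 'a::euclidean_space) \<Rightarrow> real \<Rightarrow> 'a" where
  "bounded_solution c h t = - (exp (c * t) *\<^sub>R integral {t..} (\<lambda>s. exp (- c * s) *\<^sub>R h s))"

lemma exp_weighted_absolutely_integrable:
  fixes h :: "real \<Rightarrow> 'a::euclidean_space"
  assumes "c > 0" and h: "continuous_on UNIV h" and M: "\<And>t. norm (h t) \<le> M"
  shows "(\<lambda>s. exp (- c * s) *\<^sub>R h s) absolutely_integrable_on {t..}"
proof (rule measurable_bounded_by_integrable_imp_absolutely_integrable)
  show "(\<lambda>s. exp (- c * s) *\<^sub>R h s) \<in> borel_measurable (lebesgue_on {t..})"
    by (intro continuous_imp_measurable_on_sets_lebesgue continuous_intros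
        continuous_on_subset[OF h]) auto
  show "(\<lambda>s. M * exp (- c * s)) integrable_on {t..}"
    using integrable_on_exp_minus_to_infinity[OF \<open>c > 0\<close>] by (rule integrable_on_mult_right)
  show "norm (exp (- c * s) *\<^sub>R h s) \<le> M * exp (- c * s)" for s
    using M[of s] by (simp add: mult.commute)
qed auto

lemma norm_bounded_solution_le:
  fixes h :: "real \<Rightarrow> 'a::euclidean_space"
  assumes "c > 0" and h: "continuous_on UNIV h" and M: "\<And>t. norm (h t) \<le> M"
  shows "norm (bounded_solution c h t) \<le> M / c"
proof -
  have "((\<lambda>s. exp (- c * s)) has_integral (exp (- c * t) / c)) {t..}"
    by (rule has_integral_exp_minus_to_infinity[OF \<open>c > 0\<close>])
  from has_integral_mult_right[OF this, of M]
  have I: "((\<lambda>s. M * exp (- c * s)) has_integral (M * (exp (- c * t) / c))) {t..}" .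
  have "norm (integral {t..} (\<lambda>s. exp (- c * s) *\<^sub>R h s))
      \<le> integral {t..} (\<lambda>s. M * exp (- c * s))"
  proof (rule integral_norm_bound_integral)
    show "(\<lambda>s. exp (- c * s) *\<^sub>R h s) integrable_on {t..}"
      using exp_weighted_absolutely_integrable[OF assms] set_lebesgue_integral_eq_integral(1) by blast
    show "(\<lambda>s. M * exp (- c * s)) integrable_on {t..}"
      using I by blast
    show "norm (exp (- c * s) *\<^sub>R h s) \<le> M * exp (- c * s)" for s
      using M[of s] by (simp add: mult.commute)
  qed
  also have "\<dots> = exp (- c * t) * (M / c)"
    using integral_unique[OF I] by simp
  finally have "exp (c * t) * norm (integral {t..} (\<lambda>s. exp (- c * s) *\<^sub>R h s))
      \<le> exp (c * t) * (exp (- c * t) * (M / c))"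
    by (intro mult_left_mono) auto
  also have "\<dots> = M / c"
    by (simp flip: mult.assoc exp_add)
  finally show ?thesis
    by (simp add: bounded_solution_def)
qed

lemma bounded_solution_diff:
  fixes h k :: "real \<Rightarrow> 'a::euclidean_space"
  assumes "c > 0" and "continuous_on UNIV h" "\<And>t. norm (h t) \<le> M"
    and "continuous_on UNIV k" "\<And>t. norm (k t) \<le> M'"
  shows "bounded_solution c h t - bounded_solution c k t = bounded_solution c (\<lambda>s. h s - k s) t"
proof -
  have "integral {t..} (\<lambda>s. exp (- c * s) *\<^sub>R (h s - k s))
    = integral {t..} (\<lambda>s. exp (- c * s) *\<^sub>R h s) - integral {t..} (\<lambda>s. exp (- c * s) *\<^sub>R k s)"
    unfolding scaleR_right_diff_distrib
    using assms by (intro Henstock_Kurzweil_Integration.integral_diff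
        set_lebesgue_integral_eq_integral(1) exp_weighted_absolutely_integrable)
  then show ?thesis
    by (simp add: bounded_solution_def scaleR_right_diff_distrib)
qed

lemma bounded_solution_has_vector_derivative:
  fixes h :: "real \<Rightarrow> 'a::euclidean_space"
  assumes "c > 0" and h: "continuous_on UNIV h" and M: "\<And>t. norm (h t) \<le> M"
  shows "(bounded_solution c h has_vector_derivative c *\<^sub>R bounded_solution c h t + h t) (at t)"
proof -
  let ?w = "\<lambda>s. exp (- c * s) *\<^sub>R h s"
  have int: "?w integrable_on {u..}" for u
    using exp_weighted_absolutely_integrable[OF assms] set_lebesgue_integral_eq_integral(1) by blast
  have cont: "continuous_on S ?w" for S
    by (intro continuous_intros continuous_on_subset[OF h]) auto
  have split: "integral {u..} ?w = integral {t-1..} ?w - integral {t-1..u} ?w"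
    if "u \<in> {t-1<..<t+1}" for u
  proof -
    have "(?w has_integral (integral {t-1..u} ?w + integral {u..} ?w)) ({t-1..u} \<union> {u..})"
    proof (rule has_integral_Un)
      show "(?w has_integral integral {t-1..u} ?w) {t-1..u}"
        by (intro integrable_integral integrable_continuous_real cont)
      show "(?w has_integral integral {u..} ?w) {u..}"
        by (intro integrable_integral int)
      have "{t-1..u} \<inter> {u..} \<subseteq> {u}" by auto
      then show "negligible ({t-1..u} \<inter> {u..})"
        using negligible_sing negligible_subset by blast
    qed
    moreover have "{t-1..u} \<union> {u..} = {t-1..}" using that by auto
    ultimately show ?thesis
      by (simp add: integral_unique)
  qed
  have "((\<lambda>u. integral {t-1..u} ?w) has_vector_derivative ?w t) (at t within {t-1..t+1})"
    by (rule integral_has_vector_derivative[OF cont]) auto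
  then have "((\<lambda>u. integral {t-1..u} ?w) has_vector_derivative ?w t) (at t)"
    using at_within_Icc_at[of "t-1" t "t+1"] by simp
  then have "((\<lambda>u. integral {t-1..} ?w - integral {t-1..u} ?w) has_vector_derivative - ?w t) (at t)"
    by (auto intro!: derivative_eq_intros)
  then have D: "((\<lambda>u. integral {u..} ?w) has_vector_derivative - ?w t) (at t)"
    by (rule has_vector_derivative_transform_within_open[where S = "{t-1<..<t+1}"])
       (use split in auto)
  have E: "((\<lambda>u. - exp (c * u)) has_real_derivative - (exp (c * t) * c)) (at t)"
    by (auto intro!: derivative_eq_intros)
  have eq: "bounded_solution c h = (\<lambda>u. (- exp (c * u)) *\<^sub>R integral {u..} ?w)"
    by (simp add: fun_eq_iff bounded_solution_def)
  have "exp (c * t) * exp (- c * t) = 1"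
    by (simp flip: exp_add)
  then have *: "exp (c * t) *\<^sub>R ?w t = h t"
    by simp
  show ?thesis
    unfolding eq
    by (rule has_vector_derivative_eq_rhs[OF has_vector_derivative_scaleR[OF E D]])
       (use * in \<open>simp add: mult.commute\<close>)
qed

text \<open>
A solution of \<open>v' = c v + G(t, v)\<close> in the unit ball is a fixed point of
\<open>v \<mapsto> bounded_solution c (\<lambda>s. G s (v s))\<close>. Since \<open>bounded_solution c\<close> has norm at most \<open>1 / c\<close>,
this map sends the unit ball of the bounded continuous functions to itself when
\<open>M + L \<le> c\<close>, and contracts it by the factor \<open>L / c\<close>.
\<close>

lemma semilinear_bounded_solution:
  fixes G :: "real \<Rightarrow> 'a::euclidean_space \<Rightarrow> 'a"
  assumes cont: "continuous_on (UNIV \<times> cball 0 1) (\<lambda>(t, v). G t v)"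
    and lip: "\<And>t v w. norm v \<le> 1 \<Longrightarrow> norm w \<le> 1 \<Longrightarrow> norm (G t v - G t w) \<le> L * norm (v - w)"
    and zero: "\<And>t. norm (G t 0) \<le> M"
    and "0 \<le> L" "L < c" "M + L \<le> c"
  obtains v where "\<And>t. norm (v t) \<le> 1"
    and "\<And>t. (v has_vector_derivative c *\<^sub>R v t + G t (v t)) (at t)"
proof -
  define X where "X = (cball 0 1 :: (real \<Rightarrow>\<^sub>C 'a) set)"
  define T where "T v = bounded_solution c (\<lambda>s. G s (apply_bcontfun v s))" for v
  have "c > 0" using assms by linarith
  have X: "norm (apply_bcontfun v t) \<le> 1" if "v \<in> X" for v t
    using norm_bounded[of v t] that by (simp add: X_def)
  have contG: "continuous_on UNIV (\<lambda>s. G s (apply_bcontfun v s))" if "v \<in> X" for v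
  proof -
    have "continuous_on UNIV (\<lambda>s. (\<lambda>(t, v). G t v) (s, apply_bcontfun v s))"
      by (rule continuous_on_compose2[OF cont]) (use X[OF that] in \<open>auto intro!: continuous_intros\<close>)
    then show ?thesis by simp
  qed
  have boundG: "norm (G t (apply_bcontfun v t)) \<le> c" if "v \<in> X" for v t
  proof -
    have "norm (G t (apply_bcontfun v t)) \<le> norm (G t 0) + norm (G t (apply_bcontfun v t) - G t 0)"
      by (rule norm_triangle_sub)
    also have "\<dots> \<le> M + L * norm (apply_bcontfun v t - 0)"
      using X[OF that] by (intro add_mono zero lip) auto
    also have "\<dots> \<le> M + L * 1"
      using X[OF that, of t] \<open>0 \<le> L\<close> by (intro add_mono mult_left_mono) auto
    finally show ?thesis using assms by linarith
  qed
  have deriv: "(T v has_vector_derivative c *\<^sub>R T v t + G t (apply_bcontfun v t)) (at t)"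
    if "v \<in> X" for v t
    unfolding T_def
    by (rule bounded_solution_has_vector_derivative[OF \<open>c > 0\<close> contG[OF that] boundG[OF that]])
  have bound: "norm (T v t) \<le> 1" if "v \<in> X" for v t
    using norm_bounded_solution_le[OF \<open>c > 0\<close> contG[OF that] boundG[OF that], of t] \<open>c > 0\<close>
    by (simp add: T_def)
  have bcf: "T v \<in> bcontfun" if "v \<in> X" for v
  proof (rule bcontfun_normI)
    show "continuous_on UNIV (T v)"
      using deriv[OF that] has_vector_derivative_continuous
      by (blast intro: continuous_at_imp_continuous_on)
  qed (rule bound[OF that])
  have app: "apply_bcontfun (Bcontfun (T v)) = T v" if "v \<in> X" for v
    using bcf[OF that] by (rule Bcontfun_inverse)
  have "\<exists>!v\<in>X. Bcontfun (T v) = v"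
  proof (rule Banach_fix)
    show "complete X"
      unfolding X_def by (intro closed_cball complete_eq_closed[THEN iffD2])
    show "X \<noteq> {}" "0 \<le> L / c" "L / c < 1"
      using assms \<open>c > 0\<close> by (auto simp: X_def)
    show "(\<lambda>v. Bcontfun (T v)) ` X \<subseteq> X"
      by (auto simp: X_def app[unfolded X_def] bound[unfolded X_def] intro!: norm_bound)
    show "dist (Bcontfun (T v)) (Bcontfun (T w)) \<le> L / c * dist v w"
      if "v \<in> X" "w \<in> X" for v w
    proof (rule dist_bound)
      fix t
      have "norm (T v t - T w t)
          = norm (bounded_solution c (\<lambda>s. G s (apply_bcontfun v s) - G s (apply_bcontfun w s)) t)"
        unfolding T_def
        using bounded_solution_diff[OF \<open>c > 0\<close> contG[OF that(1)] boundG[OF that(1)]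
            contG[OF that(2)] boundG[OF that(2)]] by simp
      also have "\<dots> \<le> (L * dist v w) / c"
      proof (rule norm_bounded_solution_le[OF \<open>c > 0\<close>])
        show "continuous_on UNIV (\<lambda>s. G s (apply_bcontfun v s) - G s (apply_bcontfun w s))"
          by (intro continuous_intros contG that)
        show "norm (G s (apply_bcontfun v s) - G s (apply_bcontfun w s)) \<le> L * dist v w" for s
        proof -
          have "norm (G s (apply_bcontfun v s) - G s (apply_bcontfun w s))
              \<le> L * dist (apply_bcontfun v s) (apply_bcontfun w s)"
            unfolding dist_norm by (intro lip X that)
          also have "\<dots> \<le> L * dist v w"
            using \<open>0 \<le> L\<close> by (intro mult_left_mono dist_bounded)
          finally show ?thesis .
        qed
      qed
      finally show "dist (apply_bcontfun (Bcontfun (T v)) t) (apply_bcontfun (Bcontfun (T w)) t)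
          \<le> L / c * dist v w"
        by (simp add: app that dist_norm)
    qed
  qed
  then obtain v where v: "v \<in> X" "Bcontfun (T v) = v" by blast
  then have "T v = apply_bcontfun v" using app by metis
  then show thesis
    using that[of "apply_bcontfun v"] bound[OF v(1)] deriv[OF v(1)] by simp
qed

section \<open>The largest eigenvalue of a positive semidefinite map\<close>

text \<open>
The quadratic polynomial \<open>s \<mapsto> A (x + s y) \<bullet> (x + s y)\<close> has no negative value; evaluate it at its
minimum, or far out when it is affine.
\<close>

lemma psd_Cauchy_Schwarz:
  fixes A :: "'a::real_inner \<Rightarrow> 'a"
  assumes "linear A" and sym: "\<And>x y. A x \<bullet> y = x \<bullet> A y" and psd: "\<And>x. A x \<bullet> x \<ge> 0"
  shows "(A x \<bullet> y)\<^sup>2 \<le> (A x \<bullet> x) * (A y \<bullet> y)"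
proof -
  interpret linear A by fact
  have q: "0 \<le> A x \<bullet> x + 2 * s * (A x \<bullet> y) + s\<^sup>2 * (A y \<bullet> y)" for s
  proof -
    have "A (x + s *\<^sub>R y) \<bullet> (x + s *\<^sub>R y) = A x \<bullet> x + 2 * s * (A x \<bullet> y) + s\<^sup>2 * (A y \<bullet> y)"
      using sym[of y x] by (simp add: add scale inner_commute algebra_simps power2_eq_square)
    then show ?thesis using psd by metis
  qed
  show ?thesis
  proof (cases "A y \<bullet> y = 0")
    case True
    have "A x \<bullet> y = 0"
    proof (rule ccontr)
      assume nz: "A x \<bullet> y \<noteq> 0"
      then show False
        using q[of "- (A x \<bullet> x + 1) / (2 * (A x \<bullet> y))"] True by (simp add: field_simps)
    qed
    then show ?thesis using True by simp
  next
    case False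
    then have "A y \<bullet> y > 0" using psd[of y] by linarith
    then show ?thesis
      using q[of "- (A x \<bullet> y) / (A y \<bullet> y)"] by (simp add: field_simps power2_eq_square)
  qed
qed

text \<open>
The spectrum of \<open>A\<close> lies in \<open>[0, l]\<close>, where \<open>l\<close> is the largest eigenvalue, so \<open>A\<close> is within distance
\<open>l / 2\<close> of the scalar \<open>l / 2\<close>. Without diagonalizing: \<open>l\<close> is the maximum of \<open>A y \<bullet> y\<close> on the
sphere, and Cauchy--Schwarz for the form of \<open>A\<close>, applied to \<open>x\<close> and \<open>A x\<close>, gives
\<open>A x \<bullet> A x \<le> l * (A x \<bullet> x)\<close>. At the maximizer \<open>e\<close> this inequality forces \<open>A e = l e\<close>, and for
general \<open>x\<close> it is the asserted bound, squared and expanded.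
\<close>

lemma psd_largest_eigenvalue:
  fixes A :: "'a::euclidean_space \<Rightarrow> 'a"
  assumes lin: "linear A" and sym: "\<And>x y. A x \<bullet> y = x \<bullet> A y" and psd: "\<And>x. A x \<bullet> x \<ge> 0"
    and nz: "\<exists>x. A x \<noteq> 0"
  obtains l e where "l > 0" "norm e = 1" "A e = l *\<^sub>R e"
    "\<And>x. norm (A x - (l / 2) *\<^sub>R x) \<le> l / 2 * norm x"
proof -
  interpret linear A by fact
  have contA: "continuous_on S A" for S
    using lin linear_continuous_on linear_conv_bounded_linear by blast
  have "sphere (0::'a) 1 \<noteq> {}" by simp
  moreover have "continuous_on (sphere 0 1) (\<lambda>y. A y \<bullet> y)"
    by (intro continuous_intros contA)
  ultimately have "\<exists>e\<in>sphere 0 1. \<forall>y\<in>sphere 0 1. A y \<bullet> y \<le> A e \<bullet> e"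
    by (intro continuous_attains_sup) auto
  then obtain e where e: "norm e = 1" and max: "\<And>y. norm y = 1 \<Longrightarrow> A y \<bullet> y \<le> A e \<bullet> e"
    by auto
  define l where "l = A e \<bullet> e"
  have le: "A x \<bullet> x \<le> l * (x \<bullet> x)" for x
  proof (cases "x = 0")
    case False
    have "A (x /\<^sub>R norm x) \<bullet> (x /\<^sub>R norm x) \<le> l"
      unfolding l_def by (rule max) (use False in simp)
    then show ?thesis
      using False by (simp add: scale field_simps power2_norm_eq_inner[symmetric] power2_eq_square)
  qed (simp add: zero)
  have sq: "A x \<bullet> A x \<le> l * (A x \<bullet> x)" for x
  proof (cases "A x = 0")
    case False
    have "(A x \<bullet> A x)\<^sup>2 \<le> (A x \<bullet> x) * (A (A x) \<bullet> A x)"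
      by (rule psd_Cauchy_Schwarz[OF lin sym psd])
    also have "\<dots> \<le> (A x \<bullet> x) * (l * (A x \<bullet> A x))"
      by (intro mult_left_mono le psd)
    finally have "(A x \<bullet> A x) * (A x \<bullet> A x) \<le> (l * (A x \<bullet> x)) * (A x \<bullet> A x)"
      by (simp add: power2_eq_square mult_ac)
    then show ?thesis
      using False by (simp add: mult_le_cancel_right)
  qed (simp add: zero)
  have "l \<ge> 0" using psd by (simp add: l_def)
  moreover have "l \<noteq> 0"
    using nz sq by (metis inner_gt_zero_iff less_le_not_le mult_zero_left)
  ultimately have "l > 0" by simp
  have "(A e - l *\<^sub>R e) \<bullet> (A e - l *\<^sub>R e) = A e \<bullet> A e - 2 * l * l + l * l * (e \<bullet> e)"
    by (simp add: l_def inner_commute algebra_simps)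
  also have "\<dots> \<le> 0"
    using sq[of e] e by (simp add: l_def power2_norm_eq_inner[symmetric])
  finally have "A e = l *\<^sub>R e"
    using inner_ge_zero[of "A e - l *\<^sub>R e"] by (metis antisym inner_eq_zero_iff right_minus_eq)
  have "norm (A x - (l / 2) *\<^sub>R x) \<le> l / 2 * norm x" for x
  proof (rule power2_le_imp_le)
    have "(norm (A x - (l / 2) *\<^sub>R x))\<^sup>2 = A x \<bullet> A x - l * (A x \<bullet> x) + (l / 2)\<^sup>2 * (x \<bullet> x)"
      by (simp only: power2_norm_eq_inner) (simp add: inner_commute algebra_simps power2_eq_square)
    also have "\<dots> \<le> (l / 2 * norm x)\<^sup>2"
      using sq[of x] unfolding power_mult_distrib power2_norm_eq_inner by linarith
    finally show "(norm (A x - (l / 2) *\<^sub>R x))\<^sup>2 \<le> (l / 2 * norm x)\<^sup>2" .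
  qed (use \<open>l > 0\<close> in simp)
  with \<open>l > 0\<close> e \<open>A e = l *\<^sub>R e\<close> show thesis using that by blast
qed

section \<open>A trajectory in the strong stable manifold\<close>

text \<open>
The fastest linear decay towards \<open>p\<close> is \<open>exp (- l t) e\<close>, with \<open>l\<close> the largest eigenvalue of \<open>A\<close>
and \<open>e\<close> an eigenvector. We look for a trajectory
\<open>p + \<rho> (exp (- l t) e + exp (- 2 l t) v t)\<close> with \<open>v\<close> bounded. The weight \<open>exp (- 2 l t)\<close> of the
correction is the size of the quadratic remainder \<open>R x = A x - F (p + x)\<close> along the leading term. The equation for
\<open>v\<close> is \<open>v' = 2 l v - A v + exp (2 l t) / \<rho> R\<close>. Writing \<open>2 l v - A v\<close> as \<open>3 l / 2 v + (l / 2 v - A v)\<close>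
turns it into an expanding scalar part with a perturbation of Lipschitz constant \<open>l / 2\<close>, plus
the contribution of \<open>R\<close>, which is of order \<open>\<rho>\<close>; so the fixed point theorem applies for
small \<open>\<rho>\<close>. Eigenvalues of \<open>A\<close> below \<open>l\<close>, including \<open>0\<close>, do no harm because they make \<open>v\<close> expand
even faster.
\<close>

lemma strong_stable_trajectory:
  fixes F A :: "'a::euclidean_space \<Rightarrow> 'a"
  assumes lin: "linear A" and sym: "\<And>x y. A x \<bullet> y = x \<bullet> A y" and psd: "\<And>x. A x \<bullet> x \<ge> 0"
    and nz: "\<exists>x. A x \<noteq> 0"
    and contF: "continuous_on UNIV F" and "F p = 0" and "K \<ge> 0"
    and rem: "\<And>r x y. r \<le> 1 \<Longrightarrow> norm x \<le> r \<Longrightarrow> norm y \<le> r \<Longrightarrow>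
               norm (F (p + x) - F (p + y) - A (x - y)) \<le> K * r * norm (x - y)"
  obtains \<gamma> where "\<And>t. t > 0 \<Longrightarrow> (\<gamma> has_vector_derivative - F (\<gamma> t)) (at t)"
    "(\<gamma> \<longlongrightarrow> p) at_top" "\<And>t. t > 0 \<Longrightarrow> \<gamma> t \<noteq> p"
proof -
  interpret linear A by fact
  obtain l e where l: "l > 0" and e: "norm e = 1" "A e = l *\<^sub>R e"
    and half: "\<And>x. norm (A x - (l / 2) *\<^sub>R x) \<le> l / 2 * norm x"
    using psd_largest_eigenvalue[OF lin sym psd nz] by metis
  \<comment> \<open>The remainder then adds at most \<open>l / 2\<close> to the Lipschitz constant and to the bound at \<open>v = 0\<close>.\<close>
  define \<rho> where "\<rho> = min (1 / 2) (l / (4 * (K + 1)))"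
  have \<rho>: "\<rho> > 0" "2 * \<rho> \<le> 1" "2 * K * \<rho> \<le> l / 2"
  proof -
    show "\<rho> > 0" "2 * \<rho> \<le> 1" using l \<open>K \<ge> 0\<close> by (auto simp: \<rho>_def)
    have "2 * K * \<rho> \<le> 2 * K * (l / (4 * (K + 1)))"
      using \<open>K \<ge> 0\<close> by (intro mult_left_mono) (auto simp: \<rho>_def)
    also have "\<dots> \<le> l / 2" using l \<open>K \<ge> 0\<close> by (simp add: field_simps)
    finally show "2 * K * \<rho> \<le> l / 2" .
  qed
  \<comment> \<open>Time is frozen at \<open>0\<close> for negative \<open>t\<close>, so that all bounds hold on the whole line.\<close>
  define q where "q t = exp (- l * max 0 t)" for t :: real
  have q: "0 < q t" "q t \<le> 1" for t using l by (auto simp: q_def)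
  define R where "R x = A x - F (p + x)" for x
  define X where "X t v = \<rho> *\<^sub>R (q t *\<^sub>R e + (q t)\<^sup>2 *\<^sub>R v)" for t v
  define G where "G t v = (l / 2) *\<^sub>R v - A v + (1 / (\<rho> * (q t)\<^sup>2)) *\<^sub>R R (X t v)" for t v
  have contA: "continuous_on S A" for S
    using lin linear_continuous_on linear_conv_bounded_linear by blast
  have R_diff: "norm (R x - R y) \<le> K * r * norm (x - y)"
    if "r \<le> 1" "norm x \<le> r" "norm y \<le> r" for x y r
  proof -
    have "R x - R y = - (F (p + x) - F (p + y) - A (x - y))"
      by (simp add: R_def diff)
    then show ?thesis using rem[OF that] by (metis norm_minus_cancel)
  qed
  have R0: "R 0 = 0" by (simp add: R_def zero \<open>F p = 0\<close>)
  have normX: "norm (X t v) \<le> 2 * \<rho> * q t" if "norm v \<le> 1" for t v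
  proof -
    have "norm (X t v) = \<rho> * norm (q t *\<^sub>R e + (q t)\<^sup>2 *\<^sub>R v)"
      using \<rho> by (simp add: X_def)
    also have "\<dots> \<le> \<rho> * (q t * 1 + q t * 1)"
    proof (intro mult_left_mono order_trans[OF norm_triangle_ineq] add_mono)
      show "norm (q t *\<^sub>R e) \<le> q t * 1" using e q[of t] by simp
      have "(q t)\<^sup>2 * norm v \<le> q t * 1"
        using q[of t] that by (intro mult_mono) (auto simp: power2_eq_square mult_le_one)
      then show "norm ((q t)\<^sup>2 *\<^sub>R v) \<le> q t * 1" by simp
    qed (use \<rho> in simp)
    finally show ?thesis by (simp add: algebra_simps)
  qed
  have small: "2 * \<rho> * q t \<le> 1" for t
    using \<rho> q[of t] mult_le_one[of "2 * \<rho>" "q t"] by simp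
  obtain v where v: "\<And>t. norm (v t) \<le> 1"
    and v': "\<And>t. (v has_vector_derivative (3 * l / 2) *\<^sub>R v t + G t (v t)) (at t)"
  proof (rule semilinear_bounded_solution[of G l "l / 2" "3 * l / 2"])
    show "continuous_on (UNIV \<times> cball 0 1) (\<lambda>(t, v). G t v)"
      unfolding G_def X_def R_def q_def case_prod_beta
      using \<rho> by (intro continuous_intros continuous_on_compose2[OF contA]
          continuous_on_compose2[OF contF]) auto
    show "norm (G t v - G t w) \<le> l * norm (v - w)" if "norm v \<le> 1" "norm w \<le> 1" for t v w
    proof -
      have "norm (R (X t v) - R (X t w)) \<le> K * (2 * \<rho> * q t) * norm (X t v - X t w)"
        by (rule R_diff) (use that normX small in auto)
      also have "X t v - X t w = (\<rho> * (q t)\<^sup>2) *\<^sub>R (v - w)"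
        by (simp add: X_def algebra_simps)
      also have "K * (2 * \<rho> * q t) * norm \<dots> = (\<rho> * (q t)\<^sup>2) * (2 * K * \<rho> * norm (v - w)) * q t"
        using \<rho> unfolding norm_scaleR by (simp add: mult_ac)
      also have "\<dots> \<le> (\<rho> * (q t)\<^sup>2) * (2 * K * \<rho> * norm (v - w)) * 1"
        using q[of t] \<rho> \<open>K \<ge> 0\<close> by (intro mult_left_mono) auto
      also have "\<dots> \<le> (\<rho> * (q t)\<^sup>2) * (l / 2 * norm (v - w))"
        unfolding mult_1_right using \<rho> by (intro mult_left_mono mult_right_mono) auto
      finally have "norm ((1 / (\<rho> * (q t)\<^sup>2)) *\<^sub>R (R (X t v) - R (X t w))) \<le> l / 2 * norm (v - w)"
        using \<rho> q(1)[of t] unfolding norm_scaleR by (simp add: field_simps)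
      moreover have "G t v - G t w
          = - (A (v - w) - (l / 2) *\<^sub>R (v - w)) + (1 / (\<rho> * (q t)\<^sup>2)) *\<^sub>R (R (X t v) - R (X t w))"
        by (simp add: G_def diff algebra_simps)
      moreover have "norm (- (A (v - w) - (l / 2) *\<^sub>R (v - w))) \<le> l / 2 * norm (v - w)"
        using half[of "v - w"] by (metis norm_minus_cancel)
      ultimately show ?thesis
        by (smt (verit) norm_triangle_ineq field_sum_of_halves distrib_right)
    qed
    show "norm (G t 0) \<le> l / 2" for t
    proof -
      have X0: "norm (X t 0) = \<rho> * q t"
        using e \<rho> q[of t] by (simp add: X_def)
      have "norm (R (X t 0) - R 0) \<le> K * (\<rho> * q t) * norm (X t 0 - 0)"
        using \<rho> q[of t] small[of t] by (intro R_diff) (auto simp: X0)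
      also have "\<dots> = (\<rho> * (q t)\<^sup>2) * (K * \<rho>)"
        by (simp add: X0 power2_eq_square)
      also have "\<dots> \<le> (\<rho> * (q t)\<^sup>2) * (l / 2)"
      proof (rule mult_left_mono)
        have "K * \<rho> \<ge> 0" using \<rho> \<open>K \<ge> 0\<close> by simp
        then show "K * \<rho> \<le> l / 2" using \<rho> by linarith
      qed (use \<rho> in simp)
      finally show ?thesis
        using \<rho> q(1)[of t] by (simp add: G_def zero R0 field_simps)
    qed
  qed (use l in auto)
  define \<gamma> where "\<gamma> t = p + \<rho> *\<^sub>R (exp (- l * t) *\<^sub>R e + exp (- 2 * l * t) *\<^sub>R v t)" for t
  have q_pos: "q t = exp (- l * t)" "(q t)\<^sup>2 = exp (- 2 * l * t)" if "t > 0" for t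
    using that by (auto simp: q_def exp_double[symmetric] algebra_simps)
  have \<gamma>_X: "\<gamma> t = p + X t (v t)" if "t > 0" for t
    using q_pos[OF that] by (simp add: \<gamma>_def X_def)
  show thesis
  proof
    fix t :: real assume t: "t > 0"
    let ?E = "exp (- 2 * l * t)"
    have "(\<gamma> has_vector_derivative
        \<rho> *\<^sub>R ((- l * exp (- l * t)) *\<^sub>R e
             + ((- 2 * l * ?E) *\<^sub>R v t + ?E *\<^sub>R ((3 * l / 2) *\<^sub>R v t + G t (v t))))) (at t)"
      unfolding \<gamma>_def
      by (rule derivative_eq_intros v' refl | simp add: mult_ac)+
    also have "?E *\<^sub>R ((3 * l / 2) *\<^sub>R v t + G t (v t))
        = (2 * l * ?E) *\<^sub>R v t - ?E *\<^sub>R A (v t) + (1 / \<rho>) *\<^sub>R R (X t (v t))"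
      unfolding G_def q_pos(2)[OF t] 
      by (simp add: algebra_simps scaleR_add_left[symmetric] del: scaleR_add_left)
    also have "\<rho> *\<^sub>R ((- l * exp (- l * t)) *\<^sub>R e + ((- 2 * l * ?E) *\<^sub>R v t +
         ((2 * l * ?E) *\<^sub>R v t - ?E *\<^sub>R A (v t) + (1 / \<rho>) *\<^sub>R R (X t (v t)))))
        = - A (X t (v t)) + R (X t (v t))"
      using \<rho> e(2) q_pos[OF t] by (simp add: X_def add scale scaleR_add_right scaleR_diff_right mult_ac)
    also have "\<dots> = - F (\<gamma> t)"
      by (simp add: R_def \<gamma>_X[OF t])
    finally show "(\<gamma> has_vector_derivative - F (\<gamma> t)) (at t)" .
  next
    have "((\<lambda>t. X t (v t)) \<longlongrightarrow> 0) at_top"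
    proof (rule Lim_null_comparison)
      show "\<forall>\<^sub>F t in at_top. norm (X t (v t)) \<le> 2 * \<rho> * exp (- l * t)"
        using eventually_gt_at_top[of 0] by eventually_elim (metis normX v q_pos(1))
      have "((\<lambda>t. exp (- l * t)) \<longlongrightarrow> 0) at_top"
        using l by (intro filterlim_compose[OF exp_at_bot] filterlim_tendsto_neg_mult_at_bot[OF tendsto_const])
          (auto simp: filterlim_ident)
      then show "((\<lambda>t. 2 * \<rho> * exp (- l * t)) \<longlongrightarrow> 0) at_top"
        by (rule tendsto_mult_right_zero)
    qed
    then have "((\<lambda>t. p + X t (v t)) \<longlongrightarrow> p + 0) at_top"
      by (intro tendsto_add tendsto_const)
    moreover have "\<forall>\<^sub>F t in at_top. p + X t (v t) = \<gamma> t"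
      using eventually_gt_at_top[of 0] by eventually_elim (simp add: \<gamma>_X)
    ultimately show "(\<gamma> \<longlongrightarrow> p) at_top"
      by (simp add: tendsto_cong)
  next
    fix t :: real assume t: "t > 0"
    show "\<gamma> t \<noteq> p"
    proof
      assume "\<gamma> t = p"
      then have "q t *\<^sub>R e + (q t)\<^sup>2 *\<^sub>R v t = 0"
        using \<rho> by (simp add: \<gamma>_X[OF t] X_def)
      then have "norm (q t *\<^sub>R e) = norm ((q t)\<^sup>2 *\<^sub>R v t)"
        by (metis add_eq_0_iff norm_minus_cancel)
      then have "q t = (q t)\<^sup>2 * norm (v t)"
        using e q[of t] by simp
      then have "q t * norm (v t) = 1"
        using q(1)[of t] by (simp add: power2_eq_square)
      moreover have "q t * norm (v t) \<le> q t * 1"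
        using v[of t] q(1)[of t] by (intro mult_left_mono) auto
      moreover have "q t < 1" using t l by (simp add: q_pos)
      ultimately show False by linarith
    qed
  qed
qed

section \<open>Linearization error of smooth maps and gradients\<close>

lemma linear_norm_le_Basis:
  fixes T :: "'a::euclidean_space \<Rightarrow> 'b::real_normed_vector" and M :: real
  assumes "linear T" and "\<And>i. i \<in> Basis \<Longrightarrow> norm (T i) \<le> M"
  shows "norm (T v) \<le> DIM('a) * M * norm v"
proof -
  interpret linear T by fact
  have "T v = T (\<Sum>i\<in>Basis. (v \<bullet> i) *\<^sub>R i)" by (simp add: euclidean_representation)
  also have "\<dots> = (\<Sum>i\<in>Basis. (v \<bullet> i) *\<^sub>R T i)" by (simp add: sum scale)
  also have "norm \<dots> \<le> (\<Sum>i\<in>(Basis::'a set). norm v * M)"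
    by (rule sum_norm_le) (auto intro!: mult_mono assms Basis_le_norm)
  finally show ?thesis by (simp add: mult_ac)
qed

lemma C1_increment_bound:
  fixes g :: "'a::euclidean_space \<Rightarrow> 'b::real_normed_vector"
  assumes g: "Ck_on (Suc 0) g UNIV"
  obtains L where "L \<ge> 0" "\<And>x. norm x \<le> 1 \<Longrightarrow> norm (g (p + x) - g p) \<le> L * norm x"
proof -
  let ?D = "\<lambda>x. frechet_derivative g (at x)"
  have diff: "(g has_derivative ?D x) (at x)" for x
    using g by (simp add: frechet_derivative_works)
  have "\<exists>B. \<forall>x\<in>cball p 1. norm (?D x i) \<le> B" for i
  proof -
    have "continuous_on UNIV (\<lambda>x. ?D x i)" using g by simp
    then have "continuous_on (cball p 1) (\<lambda>x. ?D x i)" by (rule continuous_on_subset) simp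
    then have "bounded ((\<lambda>x. ?D x i) ` cball p 1)"
      by (intro compact_imp_bounded compact_continuous_image compact_cball)
    then show ?thesis by (auto simp: bounded_iff)
  qed
  then obtain B where B: "\<And>i x. x \<in> cball p 1 \<Longrightarrow> norm (?D x i) \<le> B i" by metis
  define M where "M = (\<Sum>i\<in>Basis. \<bar>B i\<bar>)"
  have "M \<ge> 0" by (simp add: M_def sum_nonneg)
  have M: "norm (?D x i) \<le> M" if "i \<in> Basis" "x \<in> cball p 1" for x i
  proof -
    have "\<bar>B i\<bar> \<le> M" unfolding M_def by (rule member_le_sum) (use that in auto)
    then show ?thesis using B[OF that(2), of i] by linarith
  qed
  have "norm (g (p + x) - g p) \<le> (DIM('a) * M) * norm (p + x - p)" if "norm x \<le> 1" for x
  proof (rule differentiable_bound[where S = "cball p 1"])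
    show "(g has_derivative ?D y) (at y within cball p 1)" for y
      by (rule has_derivative_at_withinI[OF diff])
    show "onorm (?D y) \<le> DIM('a) * M" if "y \<in> cball p 1" for y
      using linear_norm_le_Basis[OF has_derivative_linear[OF diff] M]
        that by (intro onorm_le) blast
  qed (use that in \<open>auto simp: dist_norm\<close>)
  then show thesis using that[of "DIM('a) * M"] \<open>M \<ge> 0\<close> by simp
qed

text \<open>
The map \<open>z \<mapsto> g (p + z) - Dg(p) z\<close> has derivative \<open>Dg(p + z) - Dg(p)\<close>, which is \<open>O(r)\<close> on the
ball of radius \<open>r\<close> because \<open>Dg\<close> is \<open>C\<^sup>1\<close>; so it is Lipschitz there with constant \<open>O(r)\<close>.
\<close>

lemma C2_linearization_error:
  fixes g :: "'a::euclidean_space \<Rightarrow> 'b::real_normed_vector"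
  assumes g: "Ck_on (Suc (Suc 0)) g UNIV"
  obtains K where "K \<ge> 0" "\<And>r x y. r \<le> 1 \<Longrightarrow> norm x \<le> r \<Longrightarrow> norm y \<le> r \<Longrightarrow>
    norm (g (p + x) - g (p + y) - frechet_derivative g (at p) (x - y)) \<le> K * r * norm (x - y)"
proof -
  let ?D = "\<lambda>x. frechet_derivative g (at x)"
  have diff: "(g has_derivative ?D x) (at x)" for x
    using g by (simp add: frechet_derivative_works)
  then have lin: "linear (?D x)" for x by (rule has_derivative_linear)
  have "\<exists>L\<ge>0. \<forall>x. norm x \<le> 1 \<longrightarrow> norm (?D (p + x) i - ?D p i) \<le> L * norm x" for i
  proof -
    have "Ck_on (Suc 0) (\<lambda>x. ?D x i) UNIV" using g by simp
    from C1_increment_bound[OF this, of p] show ?thesis by blast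
  qed
  then obtain L where L: "\<And>i. L i \<ge> 0"
    "\<And>i x. norm x \<le> 1 \<Longrightarrow> norm (?D (p + x) i - ?D p i) \<le> L i * norm x"
    by metis
  define M where "M = (\<Sum>i\<in>Basis. L i)"
  have "M \<ge> 0" by (simp add: M_def sum_nonneg L)
  have M: "norm (?D (p + x) i - ?D p i) \<le> M * r" if "i \<in> Basis" "norm x \<le> r" "r \<le> 1" for x i r
  proof -
    have "L i \<le> M" unfolding M_def by (rule member_le_sum) (use that L in auto)
    moreover have "norm (?D (p + x) i - ?D p i) \<le> L i * norm x" using L that by auto
    moreover have "L i * norm x \<le> M * r" using that \<open>L i \<le> M\<close> L \<open>M \<ge> 0\<close> by (intro mult_mono) auto
    ultimately show ?thesis by linarith
  qed
  have "norm (g (p + x) - g (p + y) - ?D p (x - y)) \<le> (DIM('a) * M) * r * norm (x - y)"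
    if "r \<le> 1" "norm x \<le> r" "norm y \<le> r" for r x y
  proof -
    have "norm ((g (p + x) - ?D p x) - (g (p + y) - ?D p y)) \<le> (DIM('a) * (M * r)) * norm (x - y)"
    proof (rule differentiable_bound[where S = "cball 0 r"])
      have shift: "((\<lambda>z. g (p + z)) has_derivative ?D (p + z)) (at z)" for z
      proof -
        have "((\<lambda>z. p + z) has_derivative (\<lambda>z. z)) (at z)"
          by (auto intro!: derivative_eq_intros)
        from has_derivative_compose[OF this diff] show ?thesis .
      qed
      show "((\<lambda>z. g (p + z) - ?D p z) has_derivative (\<lambda>v. ?D (p + z) v - ?D p v))
           (at z within cball 0 r)" for z
        by (rule has_derivative_at_withinI, rule has_derivative_diff[OF shift linear_imp_has_derivative[OF lin]])
      show "onorm (\<lambda>v. ?D (p + z) v - ?D p v) \<le> DIM('a) * (M * r)" if "z \<in> cball 0 r" for z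
        by (rule onorm_le, rule linear_norm_le_Basis[OF linear_compose_sub[OF lin lin]], rule M)
          (use that \<open>r \<le> 1\<close> in auto)
    qed (use that in auto)
    then show ?thesis by (simp add: linear_diff[OF lin] algebra_simps)
  qed
  then show thesis using that[of "DIM('a) * M"] \<open>M \<ge> 0\<close> by simp
qed

lemma smooth_on_grad_component:
  fixes f :: "'a::euclidean_space \<Rightarrow> real"
  assumes "smooth_on f UNIV"
  shows "Ck_on k (\<lambda>x. grad f x \<bullet> b) UNIV"
proof -
  have f: "Ck_on (Suc k) f UNIV" using assms by (simp only: smooth_on_def)
  have "frechet_derivative f (at x) b = grad f x \<bullet> b" for x
  proof -
    have "GDERIV f x :> grad f x" using f by (auto intro: GDERIV_grad)
    then show ?thesis
      by (metis gderiv_def frechet_derivative_at inner_commute)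
  qed
  moreover have "Ck_on k (\<lambda>x. frechet_derivative f (at x) b) UNIV"
    using f by simp
  ultimately show ?thesis by simp
qed

lemma smooth_on_grad_linearization_error:
  fixes f :: "'a::euclidean_space \<Rightarrow> real"
  assumes "smooth_on f UNIV"
  obtains K where "K \<ge> 0" "\<And>r x y. r \<le> 1 \<Longrightarrow> norm x \<le> r \<Longrightarrow> norm y \<le> r \<Longrightarrow>
    norm (grad f (p + x) - grad f (p + y) - frechet_derivative (grad f) (at p) (x - y))
      \<le> K * r * norm (x - y)"
    and "\<And>x. grad f differentiable (at x)"
proof -
  let ?A = "frechet_derivative (grad f) (at p)"
  have comp: "(\<lambda>x. grad f x \<bullet> b) differentiable (at x)" for b x
    using smooth_on_grad_component[OF assms, of "Suc 0" b] by simp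
  then have diff: "grad f differentiable (at x)" for x
    by (subst differentiable_componentwise_within) auto
  have "((\<lambda>x. grad f x \<bullet> b) has_derivative (\<lambda>v. ?A v \<bullet> b)) (at p)" for b
    using diff[of p] unfolding frechet_derivative_works by (rule has_derivative_inner_left)
  then have A: "frechet_derivative (\<lambda>x. grad f x \<bullet> b) (at p) = (\<lambda>v. ?A v \<bullet> b)" for b
    by (metis frechet_derivative_at)
  have "\<exists>K\<ge>0. \<forall>r x y. r \<le> 1 \<longrightarrow> norm x \<le> r \<longrightarrow> norm y \<le> r \<longrightarrow>
      \<bar>(grad f (p + x) - grad f (p + y) - ?A (x - y)) \<bullet> b\<bar> \<le> K * r * norm (x - y)" for b
  proof -
    obtain K where "K \<ge> 0" and K: "\<And>r x y. r \<le> 1 \<Longrightarrow> norm x \<le> r \<Longrightarrow> norm y \<le> r \<Longrightarrow>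
        norm (grad f (p + x) \<bullet> b - grad f (p + y) \<bullet> b - ?A (x - y) \<bullet> b) \<le> K * r * norm (x - y)"
      using C2_linearization_error[OF smooth_on_grad_component[OF assms, of _ b], of p]
      unfolding A by metis
    then show ?thesis
      by (intro exI[of _ K]) (simp add: inner_diff_left)
  qed
  then obtain K where K: "\<And>b. K b \<ge> 0" "\<And>b r x y. r \<le> 1 \<Longrightarrow> norm x \<le> r \<Longrightarrow> norm y \<le> r \<Longrightarrow>
      \<bar>(grad f (p + x) - grad f (p + y) - ?A (x - y)) \<bullet> b\<bar> \<le> K b * r * norm (x - y)"
    by metis
  show thesis
  proof (rule that[of "\<Sum>b\<in>Basis. K b"])
    show "0 \<le> (\<Sum>b\<in>Basis. K b)" by (simp add: sum_nonneg K)
    show "norm (grad f (p + x) - grad f (p + y) - ?A (x - y)) \<le> (\<Sum>b\<in>Basis. K b) * r * norm (x - y)"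
      if "r \<le> 1" "norm x \<le> r" "norm y \<le> r" for r x y
    proof -
      have "norm (grad f (p + x) - grad f (p + y) - ?A (x - y))
          \<le> (\<Sum>b\<in>Basis. \<bar>(grad f (p + x) - grad f (p + y) - ?A (x - y)) \<bullet> b\<bar>)"
        by (rule norm_le_l1)
      also have "\<dots> \<le> (\<Sum>b\<in>Basis. K b * r * norm (x - y))"
        by (intro sum_mono K that)
      finally show ?thesis by (simp add: sum_distrib_right)
    qed
  qed (rule diff)
qed

section \<open>The Hessian at a minimum\<close>

text \<open>
The quantity to be bounded, with \<open>y\<close> replaced by \<open>s y\<close>, vanishes at \<open>s = 0\<close>, and its
derivative in \<open>s\<close> is the error of the linearization of \<open>F\<close> at \<open>x + s y\<close>, paired with \<open>y\<close>. The
centre \<open>p + x\<close> of the expansion is kept general because symmetry of \<open>A\<close> comes from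
walking from \<open>p\<close> to \<open>p + x + y\<close> in two ways.
\<close>

lemma second_order_expansion:
  fixes f :: "'a::euclidean_space \<Rightarrow> real"
  assumes f: "\<And>x. (f has_derivative (\<lambda>h. h \<bullet> F x)) (at x)"
    and lin: "linear A" and "K \<ge> 0"
    and F: "\<And>x. norm x \<le> 1 \<Longrightarrow> norm (F (p + x) - A x) \<le> K * (norm x)\<^sup>2"
    and xy: "norm x + norm y \<le> 1"
  shows "\<bar>f (p + x + y) - f (p + x) - (y \<bullet> A x + (y \<bullet> A y) / 2)\<bar> \<le> K * (norm x + norm y) ^ 3"
proof -
  interpret linear A by fact
  define \<phi> where "\<phi> s = f (p + x + s *\<^sub>R y) - (s * (y \<bullet> A x) + s\<^sup>2 * (y \<bullet> A y) / 2)" for s :: real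
  let ?d = "\<lambda>s. y \<bullet> F (p + x + s *\<^sub>R y) - y \<bullet> A (x + s *\<^sub>R y)"
  have "norm (\<phi> 1 - \<phi> 0) \<le> (K * (norm x + norm y) ^ 3) * norm (1 - 0 :: real)"
  proof (rule field_differentiable_bound[where S = "{0..1}"])
    fix s :: real assume s: "s \<in> {0..1}"
    have "((\<lambda>s. f (p + x + s *\<^sub>R y)) has_derivative (\<lambda>h. (h *\<^sub>R y) \<bullet> F (p + x + s *\<^sub>R y))) (at s)"
      by (rule has_derivative_compose[of "\<lambda>s. p + x + s *\<^sub>R y" "\<lambda>h. h *\<^sub>R y", OF _ f])
         (auto intro!: derivative_eq_intros)
    then have "((\<lambda>s. f (p + x + s *\<^sub>R y)) has_real_derivative (y \<bullet> F (p + x + s *\<^sub>R y))) (at s)"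
      by (simp add: has_field_derivative_def mult_commute_abs)
    then have "(\<phi> has_real_derivative ?d s) (at s)"
      unfolding \<phi>_def by (auto intro!: derivative_eq_intros simp: add scale inner_add_right)
    then show "(\<phi> has_field_derivative ?d s) (at s within {0..1})"
      by (rule has_field_derivative_at_within)
    have le: "norm (x + s *\<^sub>R y) \<le> norm x + norm y"
    proof -
      have "norm (x + s *\<^sub>R y) \<le> norm x + s * norm y"
        using norm_triangle_ineq[of x "s *\<^sub>R y"] s by simp
      also have "\<dots> \<le> norm x + 1 * norm y"
        using s by (intro add_mono mult_right_mono) auto
      finally show ?thesis by simp
    qed
    have "\<bar>?d s\<bar> \<le> norm y * norm (F (p + x + s *\<^sub>R y) - A (x + s *\<^sub>R y))"
      unfolding inner_diff_right[symmetric] by (rule Cauchy_Schwarz_ineq2)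
    also have "\<dots> \<le> (norm x + norm y) * (K * (norm x + norm y)\<^sup>2)"
    proof (intro mult_mono)
      have "norm (F (p + (x + s *\<^sub>R y)) - A (x + s *\<^sub>R y)) \<le> K * (norm (x + s *\<^sub>R y))\<^sup>2"
        by (rule F) (use le xy in linarith)
      also have "\<dots> \<le> K * (norm x + norm y)\<^sup>2"
        using le \<open>K \<ge> 0\<close> by (intro mult_left_mono power_mono) auto
      finally show "norm (F (p + x + s *\<^sub>R y) - A (x + s *\<^sub>R y)) \<le> K * (norm x + norm y)\<^sup>2"
        by (simp add: add.assoc)
    qed auto
    also have "\<dots> = K * (norm x + norm y) ^ 3" by (simp add: power2_eq_square power3_eq_cube)
    finally show "norm (?d s) \<le> K * (norm x + norm y) ^ 3" by simp
  qed auto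
  then show ?thesis by (simp add: \<phi>_def algebra_simps)
qed

lemma le_zero_if_le_mult_small:
  fixes a :: real
  assumes "\<delta> > 0" and "\<And>h. 0 < h \<Longrightarrow> h < \<delta> \<Longrightarrow> a \<le> C * h"
  shows "a \<le> 0"
proof (rule tendsto_le)
  show "((\<lambda>h. C * h) \<longlongrightarrow> 0) (at_right 0)"
    by (auto intro!: tendsto_eq_intros)
  show "\<forall>\<^sub>F h in at_right 0. a \<le> C * h"
    using eventually_at_right_less eventually_at_right_real[OF \<open>\<delta> > 0\<close>]
    by eventually_elim (use assms(2) in auto)
qed auto

text \<open>
Reaching \<open>p + h x + h y\<close> through \<open>p + h x\<close> and through \<open>p + h y\<close> must give the same value
of \<open>f\<close>. The two expansions differ by \<open>h\<^sup>2 (y \<bullet> A x - x \<bullet> A y)\<close> up to an error of order \<open>h\<^sup>3\<close>.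
\<close>

lemma second_derivative_symmetric:
  fixes f :: "'a::euclidean_space \<Rightarrow> real"
  assumes f: "\<And>x. (f has_derivative (\<lambda>h. h \<bullet> F x)) (at x)"
    and lin: "linear A" and "K \<ge> 0"
    and F: "\<And>x. norm x \<le> 1 \<Longrightarrow> norm (F (p + x) - A x) \<le> K * (norm x)\<^sup>2"
  shows "A x \<bullet> y = x \<bullet> A y"
proof -
  interpret linear A by fact
  note expand = second_order_expansion[OF f lin \<open>K \<ge> 0\<close> F]
  define n where "n = norm x + norm y"
  have "\<bar>y \<bullet> A x - x \<bullet> A y\<bar> \<le> (4 * K * n ^ 3) * h" if h: "0 < h" "h < 1 / (n + 1)" for h
  proof -
    have "n \<ge> 0" by (simp add: n_def)
    have hn: "norm (h *\<^sub>R x) + norm (h *\<^sub>R y) = h * n"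
      using h by (simp add: n_def algebra_simps)
    have "h * n \<le> h * (n + 1)" using h by simp
    also have "\<dots> \<le> 1" using h \<open>n \<ge> 0\<close> by (simp add: field_simps)
    finally have small: "h * n \<le> 1" .
    have small1: "norm (h *\<^sub>R x) \<le> h * n" "norm (h *\<^sub>R y) \<le> h * n"
      using h by (auto simp: n_def)
    let ?E = "K * (h * n) ^ 3"
    have mono: "K * (norm z) ^ 3 \<le> ?E" if "norm z \<le> h * n" for z :: 'a
      using that \<open>K \<ge> 0\<close> by (intro mult_left_mono power_mono) auto
    have 1: "\<bar>f (p + h *\<^sub>R x + h *\<^sub>R y) - f (p + h *\<^sub>R x) - (h\<^sup>2 * (y \<bullet> A x) + h\<^sup>2 * (y \<bullet> A y) / 2)\<bar> \<le> ?E"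
      using expand[of "h *\<^sub>R x" "h *\<^sub>R y"] small unfolding hn
      by (simp add: scale power2_eq_square mult_ac)
    have 2: "\<bar>f (p + h *\<^sub>R x + h *\<^sub>R y) - f (p + h *\<^sub>R y) - (h\<^sup>2 * (x \<bullet> A y) + h\<^sup>2 * (x \<bullet> A x) / 2)\<bar> \<le> ?E"
      using expand[of "h *\<^sub>R y" "h *\<^sub>R x"] small
      unfolding add.commute[of "norm (h *\<^sub>R y)"] hn
      by (simp add: scale power2_eq_square mult_ac add_ac)
    have 3: "\<bar>f (p + h *\<^sub>R x) - f p - h\<^sup>2 * (x \<bullet> A x) / 2\<bar> \<le> ?E"
      using expand[of 0 "h *\<^sub>R x"] small small1 mono[OF small1(1)]
      by (simp add: scale zero power2_eq_square mult_ac)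
    have 4: "\<bar>f (p + h *\<^sub>R y) - f p - h\<^sup>2 * (y \<bullet> A y) / 2\<bar> \<le> ?E"
      using expand[of 0 "h *\<^sub>R y"] small small1 mono[OF small1(2)]
      by (simp add: scale zero power2_eq_square mult_ac)
    have "\<bar>h\<^sup>2 * (y \<bullet> A x) - h\<^sup>2 * (x \<bullet> A y)\<bar> \<le> 4 * ?E"
      using 1 2 3 4 by linarith
    then have "h\<^sup>2 * \<bar>y \<bullet> A x - x \<bullet> A y\<bar> \<le> h\<^sup>2 * ((4 * K * n ^ 3) * h)"
      by (simp add: right_diff_distrib[symmetric] abs_mult power_mult_distrib
          power2_eq_square power3_eq_cube mult_ac)
    then show ?thesis using h by (simp add: mult_le_cancel_left)
  qed
  moreover have "n \<ge> 0" by (simp add: n_def)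
  ultimately have "\<bar>y \<bullet> A x - x \<bullet> A y\<bar> \<le> 0"
    by (intro le_zero_if_le_mult_small[of "1 / (n + 1)"]) auto
  then show ?thesis by (simp add: inner_commute)
qed

lemma second_derivative_psd_at_minimum:
  fixes f :: "'a::euclidean_space \<Rightarrow> real"
  assumes f: "\<And>x. (f has_derivative (\<lambda>h. h \<bullet> F x)) (at x)"
    and lin: "linear A" and "K \<ge> 0"
    and F: "\<And>x. norm x \<le> 1 \<Longrightarrow> norm (F (p + x) - A x) \<le> K * (norm x)\<^sup>2"
    and min: "\<And>x. f p \<le> f x"
  shows "A x \<bullet> x \<ge> 0"
proof -
  interpret linear A by fact
  define n where "n = norm x"
  have "- (x \<bullet> A x) \<le> (2 * K * n ^ 3) * h" if h: "0 < h" "h < 1 / (n + 1)" for h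
  proof -
    have "n \<ge> 0" by (simp add: n_def)
    have "h * n \<le> h * (n + 1)" using h by simp
    also have "\<dots> \<le> 1" using h \<open>n \<ge> 0\<close> by (simp add: field_simps)
    finally have "h * n \<le> 1" .
    then have "\<bar>f (p + h *\<^sub>R x) - f p - h\<^sup>2 * (x \<bullet> A x) / 2\<bar> \<le> K * (h * n) ^ 3"
      using second_order_expansion[OF f lin \<open>K \<ge> 0\<close> F, of 0 "h *\<^sub>R x"] h
      by (simp add: scale zero power2_eq_square mult_ac n_def)
    with min[of "p + h *\<^sub>R x"] have "- (h\<^sup>2 * (x \<bullet> A x) / 2) \<le> K * (h * n) ^ 3"
      by linarith
    then have "h\<^sup>2 * - (x \<bullet> A x) \<le> h\<^sup>2 * ((2 * K * n ^ 3) * h)"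
      by (simp add: power_mult_distrib power2_eq_square power3_eq_cube mult_ac)
    then show ?thesis using h by (simp only: mult_le_cancel_left) auto
  qed
  moreover have "n \<ge> 0" by (simp add: n_def)
  ultimately have "- (x \<bullet> A x) \<le> 0"
    by (intro le_zero_if_le_mult_small[of "1 / (n + 1)"]) auto
  then show ?thesis by (simp add: inner_commute)
qed

section \<open>Submanifolds of full dimension and the Hessian of a Morse--Bott function\<close>

lemma chart_derivative_inj:
  fixes \<phi> \<psi> :: "'a::euclidean_space \<Rightarrow> 'a"
  assumes "open U" "open V" "x \<in> U" and hom: "homeomorphism U V \<phi> \<psi>"
    and "smooth_on \<phi> U" "smooth_on \<psi> V"
  shows "inj (frechet_derivative \<phi> (at x))" and "(\<phi> has_derivative frechet_derivative \<phi> (at x)) (at x)"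
proof -
  let ?D = "frechet_derivative \<phi> (at x)" and ?E = "frechet_derivative \<psi> (at (\<phi> x))"
  have "\<phi> x \<in> V" using hom \<open>x \<in> U\<close> by (auto simp: homeomorphism_def)
  have "Ck_on (Suc 0) \<phi> U" "Ck_on (Suc 0) \<psi> V"
    using assms by (simp_all only: smooth_on_def)
  then have D: "(\<phi> has_derivative ?D) (at x)" and E: "(\<psi> has_derivative ?E) (at (\<phi> x))"
    using \<open>x \<in> U\<close> \<open>\<phi> x \<in> V\<close> by (simp_all add: frechet_derivative_works)
  then show "(\<phi> has_derivative ?D) (at x)" by simp
  have "((\<lambda>y. \<psi> (\<phi> y)) has_derivative (\<lambda>v. ?E (?D v))) (at x)"
    by (rule has_derivative_compose[OF D E])
  then have "((\<lambda>y. y) has_derivative (\<lambda>v. ?E (?D v))) (at x)"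
    by (rule has_derivative_transform_within_open[OF _ \<open>open U\<close> \<open>x \<in> U\<close>])
       (use hom in \<open>simp add: homeomorphism_def\<close>)
  then have "(\<lambda>v. ?E (?D v)) = (\<lambda>v. v)"
    using has_derivative_unique has_derivative_ident by blast
  then show "inj ?D" by (metis injI)
qed

lemma full_dim_subspace_UNIV:
  fixes S :: "'a::euclidean_space set"
  assumes "subspace S" "DIM('a) \<le> dim S"
  shows "S = UNIV"
  using assms dim_eq_full[of S] dim_subset_UNIV[of S] by (metis antisym span_eq_iff)

lemma open_in_subspace_imp_UNIV:
  fixes S :: "'a::euclidean_space set"
  assumes "subspace S" "open W" "W \<noteq> {}" "W \<subseteq> S"
  shows "S = UNIV"
proof -
  have "interior S \<noteq> {}" using assms interior_maximal by blast
  then have "DIM('a) \<le> dim S" using empty_interior_lowdim not_less by blast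
  then show ?thesis using \<open>subspace S\<close> by (simp add: full_dim_subspace_UNIV)
qed

lemma slice_chart_onto_imp_subset:
  assumes "homeomorphism U V \<phi> \<psi>" "\<phi> ` (M \<inter> U) = V"
  shows "U \<subseteq> M"
proof
  fix x assume "x \<in> U"
  then have "\<phi> x \<in> \<phi> ` (M \<inter> U)" using assms by (auto simp: homeomorphism_def)
  then obtain y where "y \<in> M" "y \<in> U" "\<phi> x = \<phi> y" by blast
  then show "x \<in> M" using \<open>x \<in> U\<close> assms(1) homeomorphism_apply1 by metis
qed

text \<open>
In a slice chart, velocities of curves in \<open>M\<close> are mapped into the model subspace \<open>S\<close>. If they
span the whole space, then \<open>S\<close> is the whole space, and the domain of the chart is contained in
\<open>M\<close>.
\<close>

lemma submanifold_full_tangent_imp_interior: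
  fixes M :: "'a::euclidean_space set"
  assumes "submanifold k M" "x \<in> M" "span (tangent_space M x) = UNIV"
  shows "x \<in> interior M"
proof -
  obtain U V \<phi> \<psi> S where U: "open U" "x \<in> U" "open (V :: 'a set)" and hom: "homeomorphism U V \<phi> \<psi>"
    and sm: "smooth_on \<phi> U" "smooth_on \<psi> V" and S: "subspace S" "\<phi> ` (M \<inter> U) = S \<inter> V"
    using assms(1,2) unfolding submanifold_def by meson
  let ?D = "frechet_derivative \<phi> (at x)"
  note inj = chart_derivative_inj(1)[OF U(1,3,2) hom sm]
    and D = chart_derivative_inj(2)[OF U(1,3,2) hom sm]
  have lin: "linear ?D" using D by (rule has_derivative_linear)
  have "?D v \<in> S" if v: "v \<in> tangent_space M x" for v
  proof -
    obtain c \<epsilon> where "\<epsilon> > 0" and cM: "c ` {-\<epsilon><..<\<epsilon>} \<subseteq> M" and "c 0 = x"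
      and c: "(c has_vector_derivative v) (at 0)"
      using v unfolding tangent_space_def by blast
    have "isCont c 0" using c by (rule has_vector_derivative_continuous)
    then have "(c \<longlongrightarrow> x) (at 0)" using \<open>c 0 = x\<close> by (simp add: isCont_def)
    then have evU: "\<forall>\<^sub>F t in at 0. c t \<in> U"
      using U topological_tendstoD by blast
    have evM: "\<forall>\<^sub>F t in at 0. c t \<in> M"
      unfolding eventually_at using \<open>\<epsilon> > 0\<close> cM
      by (intro exI[of _ \<epsilon>]) (force simp: dist_real_def image_subset_iff)
    have "(c has_derivative (\<lambda>h. h *\<^sub>R v)) (at 0)"
      using c by (simp add: has_vector_derivative_def)
    moreover have "(\<phi> has_derivative ?D) (at (c 0))"
      using D \<open>c 0 = x\<close> by simp
    ultimately have der: "((\<lambda>t. \<phi> (c t)) has_derivative (\<lambda>h. ?D (h *\<^sub>R v))) (at 0)"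
      by (rule has_derivative_compose)
    \<comment> \<open>Along the curve, \<open>\<phi>\<close> stays in \<open>S\<close>, so its component in any direction normal to \<open>S\<close> vanishes.\<close>
    have "?D v \<bullet> w = 0" if w: "w \<in> S\<^sup>\<bottom>" for w
    proof -
      have "((\<lambda>t. \<phi> (c t) \<bullet> w) has_derivative (\<lambda>h. ?D (h *\<^sub>R v) \<bullet> w)) (at 0)"
        using der by (rule has_derivative_inner_left)
      then have D_w: "((\<lambda>t. \<phi> (c t) \<bullet> w) has_real_derivative ?D v \<bullet> w) (at 0)"
        by (simp add: has_field_derivative_def linear_cmul[OF lin] mult_commute_abs)
      have "\<phi> (c t) \<bullet> w = 0" if "c t \<in> U" "c t \<in> M" for t
      proof -
        have "\<phi> (c t) \<in> S" using S(2) that by blast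
        then show ?thesis using w by (auto simp: orthogonal_comp_def orthogonal_def)
      qed
      then have "\<forall>\<^sub>F t in at 0. \<phi> (c t) \<bullet> w = 0" "\<phi> (c 0) \<bullet> w = 0"
        using eventually_elim2[OF evU evM] \<open>c 0 = x\<close> \<open>x \<in> M\<close> U by auto
      then have zero: "\<forall>\<^sub>F t in nhds 0. \<phi> (c t) \<bullet> w = 0"
        by (simp add: eventually_nhds_conv_at)
      have "((\<lambda>t. 0) has_real_derivative ?D v \<bullet> w) (at (0 :: real))"
        using DERIV_cong_ev[OF refl zero refl] D_w by simp
      from DERIV_unique[OF this DERIV_const] show ?thesis .
    qed
    then have "\<forall>w\<in>S\<^sup>\<bottom>. orthogonal w (?D v)"
      by (metis orthogonal_def inner_commute)
    then have "?D v \<in> S\<^sup>\<bottom>\<^sup>\<bottom>"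
      unfolding orthogonal_comp_def[of "S\<^sup>\<bottom>"] by blast
    then show ?thesis using S(1) by (simp add: orthogonal_comp_self)
  qed
  then have "?D ` span (tangent_space M x) \<subseteq> S"
    using S(1) unfolding linear_span_image[OF lin, symmetric] by (intro span_minimal) auto
  then have "range ?D \<subseteq> S" using assms(3) by simp
  moreover have "surj ?D" using inj lin linear_injective_imp_surjective by blast
  ultimately have "S = UNIV" by auto
  then have "U \<subseteq> M" using slice_chart_onto_imp_subset[OF hom] S(2) by simp
  then show ?thesis using U by (meson interiorI)
qed

text \<open>
An interior point forces the dimension \<open>k\<close> to be that of the ambient space, and \<open>k\<close> is the same at
all points of \<open>M\<close>.
\<close>

lemma submanifold_with_interior_point_open:
  fixes M :: "'a::euclidean_space set"
  assumes "submanifold k M" "p \<in> interior M"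
  shows "open M"
proof -
  have "p \<in> M" using assms(2) interior_subset by blast
  with assms(1) obtain U V \<phi> \<psi> S where U: "open U" "p \<in> U" "open (V :: 'a set)"
    and hom: "homeomorphism U V \<phi> \<psi>" and S: "subspace S" "dim S = k" "\<phi> ` (M \<inter> U) = S \<inter> V"
    unfolding submanifold_def by meson
  have "openin (top_of_set V) (\<phi> ` (interior M \<inter> U))"
    using hom U(1) by (intro homeomorphism_imp_open_map[OF hom]) (auto simp: openin_open)
  then have "open (\<phi> ` (interior M \<inter> U))" using U(3) openin_open_trans by blast
  moreover have "\<phi> ` (interior M \<inter> U) \<subseteq> S" using S(3) interior_subset by blast
  ultimately have "S = UNIV" using assms(2) U S(1) by (intro open_in_subspace_imp_UNIV) auto
  then have k: "k = DIM('a)" using S(2) by simp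
  show ?thesis
  proof (subst open_subopen, intro ballI)
    fix x assume "x \<in> M"
    with assms(1) obtain U V \<phi> \<psi> S where U: "open U" "x \<in> U" "open (V :: 'a set)"
      and hom: "homeomorphism U V \<phi> \<psi>" and S: "subspace S" "dim S = k" "\<phi> ` (M \<inter> U) = S \<inter> V"
      unfolding submanifold_def by meson
    have "S = UNIV" using S(1,2) k by (simp add: full_dim_subspace_UNIV)
    then have "U \<subseteq> M" using slice_chart_onto_imp_subset[OF hom] S(3) by simp
    then show "\<exists>T. open T \<and> x \<in> T \<and> T \<subseteq> M" using U by blast
  qed
qed

lemma critical_interior_imp_level_interior:
  fixes f :: "'a::euclidean_space \<Rightarrow> real"
  assumes f: "\<And>x. (f has_derivative (\<lambda>h. h \<bullet> grad f x)) (at x)"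
    and "p \<in> interior (critical_points f)"
  shows "p \<in> interior (f -` {f p})"
proof -
  obtain r where r: "r > 0" "ball p r \<subseteq> critical_points f"
    using assms(2) mem_interior by blast
  have "\<exists>c. \<forall>x\<in>ball p r. f x = c"
  proof (rule has_derivative_zero_constant)
    show "(f has_derivative (\<lambda>h. 0)) (at x within ball p r)" if "x \<in> ball p r" for x
    proof -
      have "grad f x = 0" using that r by (auto simp: critical_points_def)
      then show ?thesis using f[of x] has_derivative_at_withinI by fastforce
    qed
  qed simp
  then obtain c where "\<And>x. x \<in> ball p r \<Longrightarrow> f x = c" by blast
  then have "ball p r \<subseteq> f -` {f p}" using r by auto
  then show ?thesis using r mem_interior by blast
qed

text \<open>
If the Hessian at \<open>p\<close> vanished, nondegeneracy would leave no nonzero normal vector of the critical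
manifold \<open>M\<close> through \<open>p\<close>, so \<open>M\<close> would be a neighbourhood of \<open>p\<close> and \<open>f\<close> constant near \<open>p\<close>. The level
set of \<open>p\<close>, being a submanifold with an interior point, would then be open; as it is also closed
and nonempty, it would be the whole space.
\<close>

lemma morse_bott_hessian_nonzero:
  fixes f :: "'a::euclidean_space \<Rightarrow> real"
  assumes mb: "morse_bott f" and sub: "submanifold k (f -` {c})" and "f -` {c} \<noteq> UNIV"
    and p: "f p = c" "grad f p = 0"
  shows "\<exists>u. frechet_derivative (grad f) (at p) u \<noteq> 0"
proof (rule ccontr)
  assume "\<not> ?thesis"
  then have H: "hessian f p u v = 0" for u v by (simp add: hessian_def)
  have C1: "Ck_on (Suc 0) f UNIV"
    using mb by (simp add: morse_bott_def smooth_on_def del: Ck_on.simps)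
  have der: "(f has_derivative (\<lambda>h. h \<bullet> grad f x)) (at x)" for x
    using C1 GDERIV_grad by (auto simp: gderiv_def)
  have "p \<in> critical_points f" using p by (simp add: critical_points_def)
  then obtain M where "p \<in> M" and M: "nondegenerate_critical_manifold f M"
    using mb unfolding morse_bott_def by auto
  then obtain m where m: "submanifold m M" "M \<subseteq> critical_points f"
    and nd: "nondegenerate_on (normal_space M p) (hessian f p)"
    unfolding nondegenerate_critical_manifold_def critical_submanifold_def by blast
  have "normal_space M p \<subseteq> {0}" using nd H by (auto simp: nondegenerate_on_def)
  have "span (tangent_space M p) = UNIV"
  proof (rule ccontr)
    assume "span (tangent_space M p) \<noteq> UNIV"
    then obtain a where "a \<noteq> 0" "\<And>x. x \<in> span (tangent_space M p) \<Longrightarrow> orthogonal a x"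
      using span_not_UNIV_orthogonal[of "tangent_space M p"] by (auto simp: orthogonal_def)
    then have "a \<in> normal_space M p"
      by (auto simp: normal_space_def orthogonal_comp_def span_base orthogonal_commute)
    then show False using \<open>normal_space M p \<subseteq> {0}\<close> \<open>a \<noteq> 0\<close> by auto
  qed
  then have "p \<in> interior M"
    by (rule submanifold_full_tangent_imp_interior[OF m(1) \<open>p \<in> M\<close>])
  then have "p \<in> interior (critical_points f)" using interior_mono[OF m(2)] by blast
  then have "p \<in> interior (f -` {c})" using critical_interior_imp_level_interior[OF der] p by blast
  then have "open (f -` {c})" by (rule submanifold_with_interior_point_open[OF sub])
  moreover have "closed (f -` {c})"
  proof (rule continuous_closed_vimage)
    show "isCont f x" for x using has_derivative_continuous[OF der] .
  qed simp
  ultimately show False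
    using \<open>f -` {c} \<noteq> UNIV\<close> p clopen[of "f -` {c}"] by auto
qed

section \<open>Flow lines converging to a given minimum\<close>

theorem corollary4p1:
  fixes f :: "real ^ 'n \<Rightarrow> real" and p :: "real ^ 'n"
  assumes "morse_bott f"
    and "\<And>x. f x \<ge> 0"
    and "\<exists>k. submanifold k (f -` {0})"
    and "f -` {0} \<noteq> {}"
    and "f -` {0} \<noteq> UNIV"
    and "p \<in> f -` {0}"
  shows "\<exists>(a::ereal) (\<gamma> :: real \<Rightarrow> real ^ 'n).
           gradient_flow_line f a \<infinity> \<gamma> \<and>
           \<not> \<gamma> constant_on {t. a < ereal t} \<and>
           (\<gamma> \<longlongrightarrow> p) at_top"
proof -
  have smooth: "smooth_on f UNIV" using assms(1) by (simp add: morse_bott_def)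
  have "f p = 0" using assms(6) by simp
  have "Ck_on (Suc 0) f UNIV"
    using smooth by (simp add: smooth_on_def del: Ck_on.simps)
  then have der: "(f has_derivative (\<lambda>h. h \<bullet> grad f x)) (at x)" for x
    using GDERIV_grad by (auto simp: gderiv_def)
  have min: "f p \<le> f x" for x using assms(2) \<open>f p = 0\<close> by simp
  then have "(\<lambda>h. h \<bullet> grad f p) = (\<lambda>h. 0)"
    using differential_zero_maxmin[of p UNIV f, OF _ _ der] by simp
  then have crit: "grad f p = 0" by (metis (full_types) inner_eq_zero_iff)
  define A where "A = frechet_derivative (grad f) (at p)"
  obtain K where K: "K \<ge> 0"
    and rem: "\<And>r x y. r \<le> 1 \<Longrightarrow> norm x \<le> r \<Longrightarrow> norm y \<le> r \<Longrightarrow>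
      norm (grad f (p + x) - grad f (p + y) - A (x - y)) \<le> K * r * norm (x - y)"
    and diff: "\<And>x. grad f differentiable (at x)"
    using smooth_on_grad_linearization_error[OF smooth, of p] unfolding A_def by metis
  have lin: "linear A"
    using diff[of p] has_derivative_linear unfolding A_def frechet_derivative_works by blast
  \<comment> \<open>Compare \<open>p + x\<close> with the critical point \<open>p\<close> itself.\<close>
  have quad: "norm (grad f (p + x) - A x) \<le> K * (norm x)\<^sup>2" if "norm x \<le> 1" for x
    using rem[OF that, of x 0] crit by (simp add: power2_eq_square mult.assoc)
  have sym: "A x \<bullet> y = x \<bullet> A y" for x y
    by (rule second_derivative_symmetric[OF der lin K quad])
  have psd: "A x \<bullet> x \<ge> 0" for x
    by (rule second_derivative_psd_at_minimum[OF der lin K quad min])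
  have nz: "\<exists>u. A u \<noteq> 0"
    using assms(3,5) morse_bott_hessian_nonzero[OF assms(1) _ _ \<open>f p = 0\<close> crit] unfolding A_def by blast
  have cont: "continuous_on UNIV (grad f)"
    using diff by (simp add: continuous_at_imp_continuous_on differentiable_imp_continuous_within)
  obtain \<gamma> where flow: "\<And>t. t > 0 \<Longrightarrow> (\<gamma> has_vector_derivative - grad f (\<gamma> t)) (at t)"
    and lim: "(\<gamma> \<longlongrightarrow> p) at_top" and neq: "\<And>t. t > 0 \<Longrightarrow> \<gamma> t \<noteq> p"
    using strong_stable_trajectory[OF lin sym psd nz cont crit K rem] by blast
  have "\<not> \<gamma> constant_on {t. 0 < ereal t}"
  proof
    assume "\<gamma> constant_on {t. 0 < ereal t}"
    then obtain q where q: "\<And>t. t > 0 \<Longrightarrow> \<gamma> t = q"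
      by (auto simp: constant_on_def)
    have "\<forall>\<^sub>F t in at_top. \<gamma> t = q"
      using eventually_gt_at_top[of 0] by eventually_elim (rule q)
    then have "((\<lambda>t. q) \<longlongrightarrow> p) (at_top :: real filter)" using lim by (simp add: tendsto_cong)
    then have "q = p" by (simp add: tendsto_const_iff)
    then show False using neq[of 1] q[of 1] by simp
  qed
  moreover have "gradient_flow_line f 0 \<infinity> \<gamma>"
    using flow by (simp add: gradient_flow_line_def)
  ultimately show ?thesis using lim by blast
qed

end
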